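(* Let $T$ be a substitutable threshold, and let $\hat\theta$ be an estimator of the form $$\hat\theta(R,T)=\sum_{\lambda\in\Lambda_0}\beta_\lambda(x_\lambda,T_\lambda)\prod_{i\in\lambda}Z_i,$$ where $\Lambda_0$ is a collection of subsets of $[n]$ and the $\beta_\lambda$ are real-valued functions. Define $$\hat\theta(R,\tilde T)=\sum_{\lambda\in\Lambda_0}\beta_\lambda(x_\lambda,\tilde T^\lambda_\lambda)\prod_{i\in\lambda}\tilde Z^\lambda_i .$$ Then $$\hat\theta(R,T)=\hat\theta(R,\tilde T).$$ The same conclusion holds if $T$ is only $d$-substitutable and $\hat\theta$ is a polynomial of degree at most $d$ in $Z=(Z_1,\dots,Z_n)$ (i.e. $|\lambda|\le d$ for all $\lambda\in\Lambda_0$).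
   Context: Data: fixed items $x_1,\dots,x_n$, $[n]=\{1,\dots,n\}$. Each item $x_i$ has a random priority $R_i$; the priorities are independent and $R_i$ has a continuous CDF $F_i$. An adaptive thresholding rule is a function $\tau=(\tau_1,\dots,\tau_n)$ of the priority vector $\mathbf R=(R_1,\dots,R_n)$ (it may also depend on the fixed data); the threshold is $T_i=\tau_i(\mathbf R)$, and item $i$ is included in the sample iff $Z_i:=1(R_i<T_i)$ equals $1$. For $\lambda\subseteq[n]$, a subscript $\lambda$ selects the coordinates in $\lambda$, and $R_{-\lambda}$ is the vector of priorities with indices not in $\lambda$. The recalibrated threshold with respect to $\lambda$ is $$\tilde T^\lambda_i=\inf_r\{\tau_i(r): r_{-\lambda}=R_{-\lambda}\},\quad i\in[n],$$ where $r$ ranges over all possible priority vectors, and $\tilde Z^\lambda_i=1(R_i<\tilde T^\lambda_i)$. $T$ is substitutable if for every subset $\lambda\subseteq[n]$: $Z_i=1$ for all $i\in\lambda$ implies $\tilde T^\lambda_\lambda=T_\lambda$. $T$ is $d$-substitutable if this implication holds for all $\lambda$ with $|\lambda|\le d$. *)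

theory Defs
  imports "HOL-Probability.Probability"
begin

text \<open>
  Vectors indexed by [n] are extensional functions on \<open>{1..n}\<close>, and the subvector of \<open>v\<close> selected
  by \<open>J\<close> is \<open>restrict v J\<close>.  Thresholds are extended reals: a threshold may be infinite, and the
  infimum in a recalibrated threshold may be \<open>-\<infinity>\<close> even if the rule is real-valued.

  \<open>V i\<close> is the set of possible values of the \<open>i\<close>-th priority (all of \<open>\<real>\<close>, or an interval
  such as \<open>[0,1]\<close> for uniform priorities), so the possible priority vectors are the elements of
  \<open>Pi\<^sub>E {1..n} V\<close>.
\<close>

type_synonym threshold_rule = "nat \<Rightarrow> (nat \<Rightarrow> real) \<Rightarrow> ereal"

definition priority_vector :: "nat \<Rightarrow> (nat \<Rightarrow> 'w \<Rightarrow> real) \<Rightarrow> 'w \<Rightarrow> nat \<Rightarrow> real" where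
  "priority_vector n R \<omega> = (\<lambda>i\<in>{1..n}. R i \<omega>)"

definition incl :: "real \<Rightarrow> ereal \<Rightarrow> real" where
  "incl r t = of_bool (ereal r < t)"

definition recalibrated ::
    "nat \<Rightarrow> (nat \<Rightarrow> real set) \<Rightarrow> threshold_rule \<Rightarrow> nat set \<Rightarrow> threshold_rule" where
  "recalibrated n V \<tau> J i \<rho> =
     Inf {\<tau> i r | r. r \<in> Pi\<^sub>E {1..n} V \<and> restrict r ({1..n} - J) = restrict \<rho> ({1..n} - J)}"

definition substitutable_for ::
    "'w measure \<Rightarrow> nat \<Rightarrow> (nat \<Rightarrow> real set) \<Rightarrow> (nat \<Rightarrow> 'w \<Rightarrow> real) \<Rightarrow> threshold_rule \<Rightarrow>
     nat set \<Rightarrow> bool" where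
  "substitutable_for M n V R \<tau> J \<longleftrightarrow>
     (\<forall>\<omega>\<in>space M. let \<rho> = priority_vector n R \<omega> in
        (\<forall>i\<in>J. incl (\<rho> i) (\<tau> i \<rho>) = 1) \<longrightarrow>
        (\<forall>i\<in>J. recalibrated n V \<tau> J i \<rho> = \<tau> i \<rho>))"

definition substitutable ::
    "'w measure \<Rightarrow> nat \<Rightarrow> (nat \<Rightarrow> real set) \<Rightarrow> (nat \<Rightarrow> 'w \<Rightarrow> real) \<Rightarrow> threshold_rule \<Rightarrow> bool" where
  "substitutable M n V R \<tau> \<longleftrightarrow> (\<forall>J\<subseteq>{1..n}. substitutable_for M n V R \<tau> J)"

definition d_substitutable ::
    "nat \<Rightarrow> 'w measure \<Rightarrow> nat \<Rightarrow> (nat \<Rightarrow> real set) \<Rightarrow> (nat \<Rightarrow> 'w \<Rightarrow> real) \<Rightarrow> threshold_rule \<Rightarrow>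
     bool" where
  "d_substitutable d M n V R \<tau> \<longleftrightarrow>
     (\<forall>J\<subseteq>{1..n}. card J \<le> d \<longrightarrow> substitutable_for M n V R \<tau> J)"

text \<open>
  In the estimator, \<open>\<beta> J\<close> sees only the subvectors of the data and of the thresholds selected by
  \<open>J\<close>.
\<close>

definition estimator ::
    "nat set set \<Rightarrow> (nat set \<Rightarrow> (nat \<Rightarrow> 'x) \<Rightarrow> (nat \<Rightarrow> ereal) \<Rightarrow> real) \<Rightarrow> (nat \<Rightarrow> 'x) \<Rightarrow>
     threshold_rule \<Rightarrow> (nat \<Rightarrow> real) \<Rightarrow> real" where
  "estimator \<Lambda> \<beta> x \<tau> \<rho> =
     (\<Sum>J\<in>\<Lambda>. \<beta> J (restrict x J) (\<lambda>i\<in>J. \<tau> i \<rho>) * (\<Prod>i\<in>J. incl (\<rho> i) (\<tau> i \<rho>)))"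

definition recalibrated_estimator ::
    "nat \<Rightarrow> (nat \<Rightarrow> real set) \<Rightarrow> nat set set \<Rightarrow>
     (nat set \<Rightarrow> (nat \<Rightarrow> 'x) \<Rightarrow> (nat \<Rightarrow> ereal) \<Rightarrow> real) \<Rightarrow> (nat \<Rightarrow> 'x) \<Rightarrow>
     threshold_rule \<Rightarrow> (nat \<Rightarrow> real) \<Rightarrow> real" where
  "recalibrated_estimator n V \<Lambda> \<beta> x \<tau> \<rho> =
     (\<Sum>J\<in>\<Lambda>. \<beta> J (restrict x J) (\<lambda>i\<in>J. recalibrated n V \<tau> J i \<rho>) *
        (\<Prod>i\<in>J. incl (\<rho> i) (recalibrated n V \<tau> J i \<rho>)))"

end

theory Submission
  imports Defs
begin

text \<open>
  The two estimators agree term by term. If every item of \<open>J\<close> is sampled, substitutability says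
  that recalibration does not change the thresholds. Otherwise some item of \<open>J\<close> is not sampled;
  recalibration only lowers thresholds, so that item remains unsampled and both products vanish.
\<close>

text \<open>The vector \<open>\<rho>\<close> is itself a competitor in the infimum: it lies in the
  product of the sets \<open>V i\<close> and trivially agrees with itself off
  \<open>J\<close>.\<close>

lemma recalibrated_le:
  assumes "\<rho> \<in> Pi\<^sub>E {1..n} V"
  shows "recalibrated n V \<tau> J i \<rho> \<le> \<tau> i \<rho>"
  unfolding recalibrated_def using assms by (intro Inf_lower) blast

lemma priority_vector_in_PiE:
  assumes "\<And>i. i \<in> {1..n} \<Longrightarrow> R i \<omega> \<in> V i"
  shows "priority_vector n R \<omega> \<in> Pi\<^sub>E {1..n} V"
  using assms unfolding priority_vector_def by auto

lemma incl_antimono_zero: "incl r t = 0" if "incl r u = 0" "t \<le> u"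
  using that by (auto simp: incl_def)

lemma incl_zero_or_one: "incl r t = 0 \<or> incl r t = 1"
  by (simp add: incl_def)

text \<open>Common core of both claims: the term of \<open>J\<close> is compared only with its own
  recalibrated term, so substitutability is requested just for the members of
  \<open>\<Lambda>\<close>. The identity is proved for each outcome \<open>\<omega>\<close>
  separately.\<close>

lemma estimator_eq_recalibrated_estimator:
  assumes subst: "\<And>J. J \<in> \<Lambda> \<Longrightarrow> substitutable_for M n V R \<tau> J"
    and "\<omega> \<in> space M"
    and R: "\<And>i. i \<in> {1..n} \<Longrightarrow> R i \<omega> \<in> V i"
    and \<Lambda>: "\<Lambda> \<subseteq> Pow {1..n}"
  shows "estimator \<Lambda> \<beta> x \<tau> (priority_vector n R \<omega>) =
    recalibrated_estimator n V \<Lambda> \<beta> x \<tau> (priority_vector n R \<omega>)"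
  unfolding estimator_def recalibrated_estimator_def
proof (rule sum.cong[OF refl])
  fix J assume J: "J \<in> \<Lambda>"
  define \<rho> where "\<rho> = priority_vector n R \<omega>"
  let ?T = "\<lambda>i. recalibrated n V \<tau> J i \<rho>"
  \<comment> \<open>A product over an infinite set is 1 by default, so finiteness is what lets a
    single zero factor annihilate the product.\<close>
  have "finite J"
    using J \<Lambda> finite_subset by blast
  have "\<beta> J (restrict x J) (\<lambda>i\<in>J. \<tau> i \<rho>) * (\<Prod>i\<in>J. incl (\<rho> i) (\<tau> i \<rho>)) =
    \<beta> J (restrict x J) (restrict ?T J) * (\<Prod>i\<in>J. incl (\<rho> i) (?T i))"
  proof (cases "\<forall>i\<in>J. incl (\<rho> i) (\<tau> i \<rho>) = 1")
    case True
    then have T: "?T i = \<tau> i \<rho>" if "i \<in> J" for i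
      using subst[OF J] \<open>\<omega> \<in> space M\<close> that
      unfolding substitutable_for_def \<rho>_def Let_def by blast
    \<comment> \<open>\<open>\<beta> J\<close> takes a whole function as argument; both functions
      are \<open>undefined\<close> off \<open>J\<close>, so agreement on \<open>J\<close> makes them
      equal.\<close>
    then have "restrict ?T J = (\<lambda>i\<in>J. \<tau> i \<rho>)"
      by (intro restrict_ext)
    with T show ?thesis
      by simp
  next
    case False
    \<comment> \<open>An indicator other than 1 must be 0.\<close>
    then obtain i where "i \<in> J" and Z: "incl (\<rho> i) (\<tau> i \<rho>) = 0"
      using incl_zero_or_one by blast
    have "?T i \<le> \<tau> i \<rho>"
      unfolding \<rho>_def by (intro recalibrated_le priority_vector_in_PiE R)
    with Z have "incl (\<rho> i) (?T i) = 0"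
      by (rule incl_antimono_zero)
    with Z \<open>i \<in> J\<close> \<open>finite J\<close>
    have "(\<Prod>i\<in>J. incl (\<rho> i) (\<tau> i \<rho>)) = 0" "(\<Prod>i\<in>J. incl (\<rho> i) (?T i)) = 0"
      by (auto intro: prod_zero)
    then show ?thesis
      by simp
  qed
  then show "\<beta> J (restrict x J) (\<lambda>i\<in>J. \<tau> i (priority_vector n R \<omega>)) *
      (\<Prod>i\<in>J. incl (priority_vector n R \<omega> i) (\<tau> i (priority_vector n R \<omega>))) =
    \<beta> J (restrict x J) (\<lambda>i\<in>J. recalibrated n V \<tau> J i (priority_vector n R \<omega>)) *
      (\<Prod>i\<in>J. incl (priority_vector n R \<omega> i)
        (recalibrated n V \<tau> J i (priority_vector n R \<omega>)))"
    unfolding \<rho>_def .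
qed

theorem theorem4:
  fixes M :: "'w measure" and n d :: nat
    and V :: "nat \<Rightarrow> real set" and R :: "nat \<Rightarrow> 'w \<Rightarrow> real"
    and \<tau> :: threshold_rule and x :: "nat \<Rightarrow> 'x"
    and \<Lambda>\<^sub>0 :: "nat set set"
    and \<beta> :: "nat set \<Rightarrow> (nat \<Rightarrow> 'x) \<Rightarrow> (nat \<Rightarrow> ereal) \<Rightarrow> real"
  assumes "prob_space M"
    and "prob_space.indep_vars M (\<lambda>_. borel) R {1..n}"
    and "\<And>i. i \<in> {1..n} \<Longrightarrow> continuous_on UNIV (cdf (distr M borel (R i)))"
    and "\<And>i \<omega>. i \<in> {1..n} \<Longrightarrow> \<omega> \<in> space M \<Longrightarrow> R i \<omega> \<in> V i"
    and "\<Lambda>\<^sub>0 \<subseteq> Pow {1..n}"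
  shows "(substitutable M n V R \<tau> \<longrightarrow>
            (\<forall>\<omega>\<in>space M. estimator \<Lambda>\<^sub>0 \<beta> x \<tau> (priority_vector n R \<omega>) =
               recalibrated_estimator n V \<Lambda>\<^sub>0 \<beta> x \<tau> (priority_vector n R \<omega>))) \<and>
         (d_substitutable d M n V R \<tau> \<and> (\<forall>J\<in>\<Lambda>\<^sub>0. card J \<le> d) \<longrightarrow>
            (\<forall>\<omega>\<in>space M. estimator \<Lambda>\<^sub>0 \<beta> x \<tau> (priority_vector n R \<omega>) =
               recalibrated_estimator n V \<Lambda>\<^sub>0 \<beta> x \<tau> (priority_vector n R \<omega>)))"
proof (intro conjI impI ballI)
  fix \<omega> assume "substitutable M n V R \<tau>" "\<omega> \<in> space M"
  then show "estimator \<Lambda>\<^sub>0 \<beta> x \<tau> (priority_vector n R \<omega>) =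
      recalibrated_estimator n V \<Lambda>\<^sub>0 \<beta> x \<tau> (priority_vector n R \<omega>)"
    using assms(4,5) unfolding substitutable_def
    by (intro estimator_eq_recalibrated_estimator[where M = M]) auto
next
  fix \<omega> assume "d_substitutable d M n V R \<tau> \<and> (\<forall>J\<in>\<Lambda>\<^sub>0. card J \<le> d)" "\<omega> \<in> space M"
  then show "estimator \<Lambda>\<^sub>0 \<beta> x \<tau> (priority_vector n R \<omega>) =
      recalibrated_estimator n V \<Lambda>\<^sub>0 \<beta> x \<tau> (priority_vector n R \<omega>)"
    \<comment> \<open>The degree bound on \<open>\<Lambda>\<^sub>0\<close> places each of its
      members among the sets covered by \<open>d\<close>-substitutability.\<close>
    using assms(4,5) unfolding d_substitutable_def
    by (intro estimator_eq_recalibrated_estimator[where M = M]) auto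
qed

end
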